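(* Let $\Gamma=(V,E,s,r)$ be a finite quiver and let $(K,f)$ be a Hilbert representation of $\Gamma$. Then there exist a natural number $n$ and a system $\mathcal{S}$ of $n$ subspaces in a Hilbert space such that $End(K,f)\cong End(\mathcal{S})$ (isomorphism of algebras).
   Context: All Hilbert spaces are complex and subspaces are closed. A quiver $\Gamma=(V,E,s,r)$ consists of a set $V$ of vertices, a set $E$ of arrows and maps $s,r:E\to V$ (support and range); it is finite if $V$ and $E$ are finite. Loops and multiple arrows are allowed. A Hilbert representation $(K,f)$ of $\Gamma$ is a family $K=(K_v)_{v\in V}$ of Hilbert spaces together with a family $f=(f_\alpha)_{\alpha\in E}$ of bounded operators $f_\alpha:K_{s(\alpha)}\to K_{r(\alpha)}$. $End(K,f)$ is the algebra of families $(T_v)_{v\in V}$ of bounded operators $T_v\in B(K_v)$ with $T_{r(\alpha)}f_\alpha=f_\alpha T_{s(\alpha)}$ for all $\alpha\in E$. A system of $n$ subspaces $\mathcal{S}=(H;E_1,\dots,E_n)$ is a Hilbert space $H$ together with $n$ subspaces $E_1,\dots,E_n$ of $H$; $End(\mathcal{S})$ is the algebra of bounded operators $\varphi\in B(H)$ with $\varphi(E_i)\subset E_i$ for $i=1,\dots,n$. *)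

theory Defs
  imports
    "HOL-Analysis.Abstract_Metric_Spaces"
    "HOL-Algebra.Algebraic_Closure_Type"
    "Graph_Theory.Digraph"
begin

section \<open>Complex Hilbert spaces\<close>

text \<open>
  The Hilbert spaces at the different vertices of a quiver are unrelated, so a Hilbert space is a
  structure with an explicit carrier rather than a type. The fields \<open>mult\<close> and \<open>one\<close>,
  which every module record inherits from rings, play no role.
\<close>

record 'a hilbert = "(complex, 'a) module" +
  ip :: "'a \<Rightarrow> 'a \<Rightarrow> complex"

abbreviation complex_ring :: "complex ring" where
  "complex_ring \<equiv> ring_of_type_algebra"

definition hnorm :: "'a hilbert \<Rightarrow> 'a \<Rightarrow> real" where
  "hnorm H x = sqrt (Re (ip H x x))"

text \<open>
  The locale \<open>Metric_space\<close> demands nonnegativity and symmetry of the distance also outside the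
  carrier; hence the case distinction.
\<close>

definition hdist :: "'a hilbert \<Rightarrow> 'a \<Rightarrow> 'a \<Rightarrow> real" where
  "hdist H x y = (if x \<in> carrier H \<and> y \<in> carrier H then hnorm H (x \<ominus>\<^bsub>H\<^esub> y) else 0)"

locale pre_hilbert_space = module complex_ring H for H :: "'a hilbert" (structure) +
  assumes ip_commute:
      "\<lbrakk>x \<in> carrier H; y \<in> carrier H\<rbrakk> \<Longrightarrow> ip H y x = cnj (ip H x y)"
    and ip_add_left:
      "\<lbrakk>x \<in> carrier H; y \<in> carrier H; z \<in> carrier H\<rbrakk> \<Longrightarrow> ip H (x \<oplus> y) z = ip H x z + ip H y z"
    and ip_smult_left:
      "\<lbrakk>x \<in> carrier H; y \<in> carrier H\<rbrakk> \<Longrightarrow> ip H (c \<odot> x) y = c * ip H x y"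
    and ip_nonneg: "x \<in> carrier H \<Longrightarrow> 0 \<le> Re (ip H x x)"
    and ip_definite: "\<lbrakk>x \<in> carrier H; ip H x x = 0\<rbrakk> \<Longrightarrow> x = \<zero>"
begin

lemma ip_add_right:
  assumes "x \<in> carrier H" "y \<in> carrier H" "z \<in> carrier H"
  shows "ip H x (y \<oplus> z) = ip H x y + ip H x z"
  using assms by (metis M.add.m_closed complex_cnj_add ip_add_left ip_commute)

lemma smult_carrier [simp]: "x \<in> carrier H \<Longrightarrow> c \<odot> x \<in> carrier H"
  by (simp add: smult_closed ring_of_type_algebra_def)

lemma ip_smult_right:
  assumes "x \<in> carrier H" "y \<in> carrier H"
  shows "ip H x (c \<odot> y) = cnj c * ip H x y"
  using assms ip_commute[of "c \<odot> y" x] ip_commute[of y x] by (simp add: ip_smult_left)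

lemma uminus_smult:
  assumes "x \<in> carrier H" shows "\<ominus> x = (- 1) \<odot> x"
proof -
  have "(- 1) \<odot> x \<oplus> x = ((- 1) \<oplus>\<^bsub>complex_ring\<^esub> 1) \<odot> x"
    using assms smult_l_distr[of "- 1" 1 x] smult_one[of x]
    by (simp add: ring_of_type_algebra_def)
  also have "\<dots> = \<zero>"
    using smult_l_null[OF assms] by (simp add: ring_of_type_algebra_def)
  finally show ?thesis
    using assms by (simp add: M.minus_equality)
qed

lemma hnorm_zero_iff: "x \<in> carrier H \<Longrightarrow> hnorm H x = 0 \<longleftrightarrow> x = \<zero>"
proof
  assume x: "x \<in> carrier H" and "hnorm H x = 0"
  then have "Re (ip H x x) = 0" by (simp add: hnorm_def)
  moreover have "Im (ip H x x) = 0" using ip_commute[OF x x] by (metis Reals_cnj_iff complex_is_Real_iff)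
  ultimately show "x = \<zero>" using x ip_definite complex_eq_iff by simp
next
  assume x: "x \<in> carrier H" and z: "x = \<zero>"
  have "ip H x x = ip H (0 \<odot> x) x"
    using z smult_l_null[OF x] by (simp add: ring_of_type_algebra_def)
  then show "hnorm H x = 0" using x by (simp add: ip_smult_left hnorm_def)
qed

lemma hnorm_nonneg: "x \<in> carrier H \<Longrightarrow> 0 \<le> hnorm H x"
  by (simp add: hnorm_def ip_nonneg)

lemma hnorm_square: "x \<in> carrier H \<Longrightarrow> (hnorm H x)\<^sup>2 = Re (ip H x x)"
  by (simp add: hnorm_def ip_nonneg)

lemma hnorm_uminus:
  assumes "x \<in> carrier H" shows "hnorm H (\<ominus> x) = hnorm H x"
  using assms by (simp add: hnorm_def uminus_smult ip_smult_left ip_smult_right)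

lemma Re_ip_le:
  assumes x: "x \<in> carrier H" and y: "y \<in> carrier H"
  shows "Re (ip H x y) \<le> hnorm H x * hnorm H y"
proof -
  have *: "0 \<le> t\<^sup>2 * (hnorm H x)\<^sup>2 - 2 * (s * t) * Re (ip H x y) + s\<^sup>2 * (hnorm H y)\<^sup>2" for s t :: real
  proof -
    let ?t = "complex_of_real t" and ?s = "- complex_of_real s"
    have "0 \<le> Re (ip H (?t \<odot> x \<oplus> ?s \<odot> y) (?t \<odot> x \<oplus> ?s \<odot> y))"
      using x y by (intro ip_nonneg) simp
    then show ?thesis
      unfolding hnorm_square[OF x] hnorm_square[OF y]
      using x y ip_commute[OF x y]
      by (simp add: ip_add_left ip_add_right ip_smult_left ip_smult_right
          power2_eq_square algebra_simps)
  qed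
  let ?a = "hnorm H x" and ?b = "hnorm H y"
  show ?thesis
  proof (cases "?a = 0 \<or> ?b = 0")
    case True
    then have "x = \<zero> \<or> y = \<zero>" using x y hnorm_zero_iff by blast
    then have "x = 0 \<odot> x \<or> y = 0 \<odot> y"
      using x y smult_l_null[of x] smult_l_null[of y] by (auto simp: ring_of_type_algebra_def)
    then have "ip H x y = 0"
      using x y by (metis ip_smult_left ip_smult_right mult_zero_left complex_cnj_zero)
    then show ?thesis using True by auto
  next
    case False
    then have pos: "0 < ?a" "0 < ?b" using x y hnorm_nonneg by force+
    have "0 \<le> 2 * (?a * ?b) * (?a * ?b - Re (ip H x y))"
      using *[of ?b ?a] by (simp add: power2_eq_square algebra_simps)
    moreover have "0 < 2 * (?a * ?b)" using pos by simp
    ultimately have "0 \<le> ?a * ?b - Re (ip H x y)" by (metis mult_pos_neg linorder_not_less)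
    then show ?thesis by simp
  qed
qed

lemma hnorm_triangle:
  assumes x: "x \<in> carrier H" and y: "y \<in> carrier H"
  shows "hnorm H (x \<oplus> y) \<le> hnorm H x + hnorm H y"
proof (rule power2_le_imp_le)
  show "(hnorm H (x \<oplus> y))\<^sup>2 \<le> (hnorm H x + hnorm H y)\<^sup>2"
    using x y Re_ip_le[OF x y] ip_commute[OF x y]
    by (simp add: hnorm_square power2_sum ip_add_left ip_add_right)
qed (simp add: x y hnorm_nonneg)

lemma Metric_space_hdist: "Metric_space (carrier H) (hdist H)"
proof
  fix x y
  show "0 \<le> hdist H x y" by (simp add: hdist_def hnorm_nonneg)
  show "hdist H x y = hdist H y x"
    using hnorm_uminus[of "x \<ominus> y"]
    by (auto simp: hdist_def M.minus_add M.minus_minus a_minus_def M.a_comm)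
next
  fix x y assume "x \<in> carrier H" "y \<in> carrier H"
  moreover from this have "x \<ominus> y = \<zero> \<longleftrightarrow> x = y"
    by (metis M.add.inv_closed M.l_neg M.minus_equality M.minus_minus M.r_neg a_minus_def)
  ultimately show "hdist H x y = 0 \<longleftrightarrow> x = y"
    by (simp add: hdist_def hnorm_zero_iff)
next
  fix x y z assume xyz: "x \<in> carrier H" "y \<in> carrier H" "z \<in> carrier H"
  then have "(x \<ominus> y) \<oplus> (y \<ominus> z) = x \<ominus> z"
    by (simp add: a_minus_def M.a_assoc M.r_neg1 M.r_neg2)
  then show "hdist H x z \<le> hdist H x y + hdist H y z"
    using xyz hnorm_triangle[of "x \<ominus> y" "y \<ominus> z"] by (simp add: hdist_def)
qed

end

locale hilbert_space = pre_hilbert_space +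
  assumes complete: "Metric_space.mcomplete (carrier H) (hdist H)"

definition closed_subspace :: "'a set \<Rightarrow> 'a hilbert \<Rightarrow> bool" where
  "closed_subspace E H \<longleftrightarrow>
    submodule E complex_ring H \<and> closedin (Metric_space.mtopology (carrier H) (hdist H)) E"

section \<open>Bounded operators\<close>

text \<open>
  Operators are extensional (\<open>undefined\<close> outside the carrier), so that equality of operators is
  equality of functions.
\<close>

definition bounded_ops :: "'a hilbert \<Rightarrow> 'b hilbert \<Rightarrow> ('a \<Rightarrow> 'b) set" where
  "bounded_ops H K = {T \<in> carrier H \<rightarrow>\<^sub>E carrier K.
    (\<forall>x \<in> carrier H. \<forall>y \<in> carrier H. T (x \<oplus>\<^bsub>H\<^esub> y) = T x \<oplus>\<^bsub>K\<^esub> T y) \<and>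
    (\<forall>c. \<forall>x \<in> carrier H. T (c \<odot>\<^bsub>H\<^esub> x) = c \<odot>\<^bsub>K\<^esub> T x) \<and>
    (\<exists>C. \<forall>x \<in> carrier H. hnorm K (T x) \<le> C * hnorm H x)}"

text \<open>The record type of modules also has the fields of a (not necessarily commutative) algebra.\<close>

definition op_algebra :: "'a hilbert \<Rightarrow> (complex, 'a \<Rightarrow> 'a) module" where
  "op_algebra H = \<lparr>carrier = bounded_ops H H,
    monoid.mult = compose (carrier H),
    one = (\<lambda>x \<in> carrier H. x),
    zero = (\<lambda>x \<in> carrier H. \<zero>\<^bsub>H\<^esub>),
    add = (\<lambda>S T. \<lambda>x \<in> carrier H. S x \<oplus>\<^bsub>H\<^esub> T x),
    module.smult = (\<lambda>c T. \<lambda>x \<in> carrier H. c \<odot>\<^bsub>H\<^esub> T x)\<rparr>"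

definition algebra_iso ::
    "(complex, 'a) module \<Rightarrow> (complex, 'b) module \<Rightarrow> ('a \<Rightarrow> 'b) set" where
  "algebra_iso A B = {\<Phi> \<in> ring_iso A B. \<forall>c. \<forall>x \<in> carrier A. \<Phi> (c \<odot>\<^bsub>A\<^esub> x) = c \<odot>\<^bsub>B\<^esub> \<Phi> x}"

section \<open>Hilbert representations of quivers\<close>

text \<open>
  A quiver is a \<open>wf_digraph\<close>, where loops and parallel arcs are allowed; \<open>tail\<close> is the support map
  \<open>s\<close> and \<open>head\<close> is the range map \<open>r\<close>.
\<close>

locale hilbert_representation = wf_digraph \<Gamma>
  for \<Gamma> :: "('v, 'e) pre_digraph" (structure) +
  fixes K :: "'v \<Rightarrow> 'a hilbert" and f :: "'e \<Rightarrow> 'a \<Rightarrow> 'a"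
  assumes space: "v \<in> verts \<Gamma> \<Longrightarrow> hilbert_space (K v)"
    and operator: "\<alpha> \<in> arcs \<Gamma> \<Longrightarrow> f \<alpha> \<in> bounded_ops (K (tail \<Gamma> \<alpha>)) (K (head \<Gamma> \<alpha>))"

definition End_rep ::
    "('v, 'e) pre_digraph \<Rightarrow> ('v \<Rightarrow> 'a hilbert) \<Rightarrow> ('e \<Rightarrow> 'a \<Rightarrow> 'a) \<Rightarrow> (complex, 'v \<Rightarrow> 'a \<Rightarrow> 'a) module"
  where
  "End_rep \<Gamma> K f = \<lparr>carrier = {T \<in> (\<Pi>\<^sub>E v \<in> verts \<Gamma>. bounded_ops (K v) (K v)).
      \<forall>\<alpha> \<in> arcs \<Gamma>. \<forall>x \<in> carrier (K (tail \<Gamma> \<alpha>)).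
        T (head \<Gamma> \<alpha>) (f \<alpha> x) = f \<alpha> (T (tail \<Gamma> \<alpha>) x)},
    monoid.mult = (\<lambda>S T. \<lambda>v \<in> verts \<Gamma>. S v \<otimes>\<^bsub>op_algebra (K v)\<^esub> T v),
    one = (\<lambda>v \<in> verts \<Gamma>. \<one>\<^bsub>op_algebra (K v)\<^esub>),
    zero = (\<lambda>v \<in> verts \<Gamma>. \<zero>\<^bsub>op_algebra (K v)\<^esub>),
    add = (\<lambda>S T. \<lambda>v \<in> verts \<Gamma>. S v \<oplus>\<^bsub>op_algebra (K v)\<^esub> T v),
    module.smult = (\<lambda>c T. \<lambda>v \<in> verts \<Gamma>. c \<odot>\<^bsub>op_algebra (K v)\<^esub> T v)\<rparr>"

section \<open>Systems of subspaces\<close>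

locale subspace_system = hilbert_space H for H :: "'a hilbert" (structure) +
  fixes n :: nat and E :: "nat \<Rightarrow> 'a set"
  assumes subspace: "i \<in> {1..n} \<Longrightarrow> closed_subspace (E i) H"

definition End_system ::
    "'a hilbert \<Rightarrow> nat \<Rightarrow> (nat \<Rightarrow> 'a set) \<Rightarrow> (complex, 'a \<Rightarrow> 'a) module" where
  "End_system H n E = (op_algebra H)
    \<lparr>carrier := {\<phi> \<in> bounded_ops H H. \<forall>i \<in> {1..n}. \<phi> ` E i \<subseteq> E i}\<rparr>"

text \<open>
  HOL cannot assert the existence of a Hilbert space without naming a type for its elements. For a
  representation with vertices in \<open>'v\<close> and vectors in \<open>'a\<close>, the following type has room for the
  Hilbert direct sum of the spaces \<open>K v\<close> and for a second copy of it.
\<close>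

type_synonym ('v, 'a) double_sum = "('v \<Rightarrow> 'a) \<times> ('v \<Rightarrow> 'a)"

end

theory Submission
  imports Defs "HOL-Analysis.L2_Norm"
begin

text \<open>
  Let \<open>L\<close> be the Hilbert sum of the spaces \<open>K v\<close> and let \<open>H = L \<oplus> L\<close>, with coordinates \<open>x\<^sub>v\<close> in the
  first and \<open>y\<^sub>v\<close> in the second copy. The subspaces of \<open>H\<close> that do the job are of three kinds:

  \<^item> the kernels \<open>x\<^sub>v = 0\<close> and \<open>y\<^sub>v = 0\<close> of all coordinates,
  \<^item> for each vertex the subspace \<open>y\<^sub>v = x\<^sub>v\<close>,
  \<^item> for each arrow \<open>\<alpha>\<close> from \<open>s\<close> to \<open>r\<close> the subspace \<open>y\<^sub>r = f \<alpha> x\<^sub>s\<close>.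

  Each is the set where two bounded operators agree, hence closed, and there are finitely many.
  An operator on \<open>H\<close> that preserves the kernel of a coordinate induces an operator on that
  coordinate space, so an operator that preserves all the kernels is diagonal
  (\<open>diagonal_if_preserves_kernels\<close>). A diagonal operator with entries \<open>S\<^sub>v\<close> on the first and \<open>T\<^sub>v\<close> on
  the second copy preserves \<open>y\<^sub>w = a x\<^sub>v\<close> exactly if \<open>T\<^sub>w a = a S\<^sub>v\<close>
  (\<open>diagonal_preserves_graph_iff\<close>). For \<open>a = 1\<close> this says that the entries on the two copies
  coincide, and for \<open>a = f \<alpha>\<close> it then says that the common entries \<open>T\<^sub>v\<close> intertwine \<open>f \<alpha>\<close>.
  Thus the operators that preserve the system are exactly the \<open>T \<oplus> T\<close> with \<open>T\<close> in \<open>End(K,f)\<close>, and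
  \<open>T \<mapsto> T \<oplus> T\<close> respects the algebra operations.

  The second copy of \<open>L\<close> is what makes loops harmless: for a loop \<open>\<alpha>\<close> at \<open>v\<close>, the condition
  \<open>x\<^sub>v = f \<alpha> x\<^sub>v\<close> inside a single copy only describes the fixed vectors of \<open>f \<alpha>\<close>, whereas in two
  copies the input and the output of \<open>f \<alpha>\<close> are independent coordinates.
\<close>

section \<open>Bounded operators\<close>

lemma (in pre_hilbert_space) minus_eq_add_smult:
  "\<lbrakk>x \<in> carrier H; y \<in> carrier H\<rbrakk> \<Longrightarrow> x \<ominus> y = x \<oplus> (- 1) \<odot> y"
  by (simp add: a_minus_def uminus_smult)

lemma (in pre_hilbert_space) minus_eq_zero_iff:
  "\<lbrakk>x \<in> carrier H; y \<in> carrier H\<rbrakk> \<Longrightarrow> x \<ominus> y = \<zero> \<longleftrightarrow> x = y"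
  by (metis M.add.inv_closed M.l_neg M.minus_equality M.minus_minus M.r_neg a_minus_def)

lemma (in pre_hilbert_space) smult_zero_left: "x \<in> carrier H \<Longrightarrow> 0 \<odot> x = \<zero>"
  using smult_l_null[of x] by (simp add: ring_of_type_algebra_def)

lemma (in pre_hilbert_space) smult_zero_right: "c \<odot> \<zero> = \<zero>"
  using smult_r_null[of c] by (simp add: ring_of_type_algebra_def)

lemma (in pre_hilbert_space) hnorm_zero: "hnorm H \<zero> = 0"
  by (simp add: hnorm_zero_iff)

locale pre_hilbert_pair = H: pre_hilbert_space H + K: pre_hilbert_space K
  for H :: "'a hilbert" and K :: "'b hilbert"
begin

lemma op_closed: "\<lbrakk>T \<in> bounded_ops H K; x \<in> carrier H\<rbrakk> \<Longrightarrow> T x \<in> carrier K"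
  by (auto simp: bounded_ops_def)

lemma op_add:
  "\<lbrakk>T \<in> bounded_ops H K; x \<in> carrier H; y \<in> carrier H\<rbrakk> \<Longrightarrow> T (x \<oplus>\<^bsub>H\<^esub> y) = T x \<oplus>\<^bsub>K\<^esub> T y"
  by (auto simp: bounded_ops_def)

lemma op_smult:
  "\<lbrakk>T \<in> bounded_ops H K; x \<in> carrier H\<rbrakk> \<Longrightarrow> T (c \<odot>\<^bsub>H\<^esub> x) = c \<odot>\<^bsub>K\<^esub> T x"
  by (auto simp: bounded_ops_def)

lemma op_bound:
  assumes "T \<in> bounded_ops H K"
  obtains C where "0 \<le> C" "\<And>x. x \<in> carrier H \<Longrightarrow> hnorm K (T x) \<le> C * hnorm H x"
proof -
  obtain C where C: "\<And>x. x \<in> carrier H \<Longrightarrow> hnorm K (T x) \<le> C * hnorm H x"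
    using assms unfolding bounded_ops_def by blast
  have "hnorm K (T x) \<le> \<bar>C\<bar> * hnorm H x" if "x \<in> carrier H" for x
    using C[OF that] mult_right_mono[of C "\<bar>C\<bar>" "hnorm H x"] H.hnorm_nonneg[OF that] by linarith
  then show ?thesis using that[of "\<bar>C\<bar>"] by simp
qed

lemma op_minus:
  assumes "T \<in> bounded_ops H K" "x \<in> carrier H" "y \<in> carrier H"
  shows "T (x \<ominus>\<^bsub>H\<^esub> y) = T x \<ominus>\<^bsub>K\<^esub> T y"
  using assms by (simp add: H.minus_eq_add_smult K.minus_eq_add_smult op_closed op_add op_smult)

lemma op_zero: "T \<in> bounded_ops H K \<Longrightarrow> T \<zero>\<^bsub>H\<^esub> = \<zero>\<^bsub>K\<^esub>"
  by (metis H.M.zero_closed H.smult_zero_left K.smult_zero_left op_closed op_smult)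

lemma op_eqI:
  assumes "S \<in> bounded_ops H K" "T \<in> bounded_ops H K" "\<And>x. x \<in> carrier H \<Longrightarrow> S x = T x"
  shows "S = T"
  using assms by (auto simp: bounded_ops_def intro: PiE_ext)

lemma op_Lipschitz:
  assumes T: "T \<in> bounded_ops H K"
  shows "Lipschitz_continuous_map (metric (carrier H, hdist H)) (metric (carrier K, hdist K)) T"
proof -
  interpret MH: Metric_space "carrier H" "hdist H" by (rule H.Metric_space_hdist)
  interpret MK: Metric_space "carrier K" "hdist K" by (rule K.Metric_space_hdist)
  obtain C where C: "\<And>x. x \<in> carrier H \<Longrightarrow> hnorm K (T x) \<le> C * hnorm H x"
    using op_bound[OF T] by blast
  have "hdist K (T x) (T y) \<le> C * hdist H x y" if "x \<in> carrier H" "y \<in> carrier H" for x y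
    using that C[of "x \<ominus>\<^bsub>H\<^esub> y"] T by (simp add: hdist_def op_closed op_minus)
  then show ?thesis
    using op_closed[OF T] by (auto simp: Lipschitz_continuous_map_def)
qed

text \<open>
  Bounded operators are Lipschitz, hence continuous, and two continuous maps into a Hausdorff space
  agree on a closed set. All subspaces of the system arise in this way.
\<close>

lemma closed_subspace_equalizer:
  assumes S: "S \<in> bounded_ops H K" and T: "T \<in> bounded_ops H K"
  shows "closed_subspace {x \<in> carrier H. S x = T x} H"
  unfolding closed_subspace_def
proof
  show "submodule {x \<in> carrier H. S x = T x} complex_ring H"
    using S T by (intro H.submoduleI) (auto simp: op_zero op_add op_smult H.uminus_smult)
  interpret MH: Metric_space "carrier H" "hdist H" by (rule H.Metric_space_hdist)
  interpret MK: Metric_space "carrier K" "hdist K" by (rule K.Metric_space_hdist)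
  have "continuous_map MH.mtopology MK.mtopology R" if "R \<in> bounded_ops H K" for R
    using Lipschitz_continuous_imp_continuous_map[OF op_Lipschitz[OF that]] by (simp add: mtopology_of_def)
  from closedin_continuous_maps_eq[OF MK.Hausdorff_space_mtopology this[OF S] this[OF T]]
  show "closedin MH.mtopology {x \<in> carrier H. S x = T x}" by simp
qed

lemma zero_op: "(\<lambda>x \<in> carrier H. \<zero>\<^bsub>K\<^esub>) \<in> bounded_ops H K"
  by (auto simp: bounded_ops_def K.smult_zero_right K.hnorm_zero intro!: exI[of _ 0])

end

lemma compose_bounded_ops:
  assumes H: "pre_hilbert_space H" and K: "pre_hilbert_space K" and L: "pre_hilbert_space L"
    and S: "S \<in> bounded_ops K L" and T: "T \<in> bounded_ops H K"
  shows "compose (carrier H) S T \<in> bounded_ops H L"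
proof -
  interpret HK: pre_hilbert_pair H K using H K by (rule pre_hilbert_pair.intro)
  interpret KL: pre_hilbert_pair K L using K L by (rule pre_hilbert_pair.intro)
  obtain C where C: "0 \<le> C" "\<And>x. x \<in> carrier K \<Longrightarrow> hnorm L (S x) \<le> C * hnorm K x"
    using KL.op_bound[OF S] by blast
  obtain D where D: "\<And>x. x \<in> carrier H \<Longrightarrow> hnorm K (T x) \<le> D * hnorm H x"
    using HK.op_bound[OF T] by blast
  have "hnorm L (S (T x)) \<le> (C * D) * hnorm H x" if "x \<in> carrier H" for x
    using C(2)[of "T x"] mult_left_mono[OF D[OF that] C(1)] HK.op_closed[OF T that]
    by (simp add: mult.assoc)
  then show ?thesis
    using S T by (auto simp: bounded_ops_def compose_def Pi_iff PiE_iff)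
qed

section \<open>Finite orthogonal sums\<close>

text \<open>
  The elements of \<open>H\<close> have an arbitrary type and are accessed only through their coordinates, with
  \<open>tuple\<close> as the inverse of taking all coordinates. In this way the sum of two copies of a family
  of spaces, realized by pairs of functions, is an instance with a disjoint union as index set.
\<close>

locale orthogonal_sum =
  fixes J :: "'j set" and K :: "'j \<Rightarrow> 'a hilbert" and H :: "'b hilbert" (structure)
    and coord :: "'j \<Rightarrow> 'b \<Rightarrow> 'a" and tuple :: "('j \<Rightarrow> 'a) \<Rightarrow> 'b"
  assumes finite_index: "finite J"
    and summand: "j \<in> J \<Longrightarrow> hilbert_space (K j)"
    and coord_closed: "\<lbrakk>j \<in> J; z \<in> carrier H\<rbrakk> \<Longrightarrow> coord j z \<in> carrier (K j)"
    and coord_eqI: "\<lbrakk>x \<in> carrier H; y \<in> carrier H; \<And>j. j \<in> J \<Longrightarrow> coord j x = coord j y\<rbrakk> \<Longrightarrow> x = y"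
    and tuple_closed: "(\<And>j. j \<in> J \<Longrightarrow> k j \<in> carrier (K j)) \<Longrightarrow> tuple k \<in> carrier H"
    and coord_tuple: "\<lbrakk>\<And>j. j \<in> J \<Longrightarrow> k j \<in> carrier (K j); j \<in> J\<rbrakk> \<Longrightarrow> coord j (tuple k) = k j"
    and zero_eq: "\<zero>\<^bsub>H\<^esub> = tuple (\<lambda>j. \<zero>\<^bsub>K j\<^esub>)"
    and add_eq: "\<lbrakk>x \<in> carrier H; y \<in> carrier H\<rbrakk> \<Longrightarrow>
      x \<oplus>\<^bsub>H\<^esub> y = tuple (\<lambda>j. coord j x \<oplus>\<^bsub>K j\<^esub> coord j y)"
    and smult_eq: "x \<in> carrier H \<Longrightarrow> c \<odot>\<^bsub>H\<^esub> x = tuple (\<lambda>j. c \<odot>\<^bsub>K j\<^esub> coord j x)"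
    and ip_eq: "\<lbrakk>x \<in> carrier H; y \<in> carrier H\<rbrakk> \<Longrightarrow>
      ip H x y = (\<Sum>j\<in>J. ip (K j) (coord j x) (coord j y))"
begin

lemma summand_pre: "j \<in> J \<Longrightarrow> pre_hilbert_space (K j)"
  using summand hilbert_space_def by blast

lemma summand_module: "j \<in> J \<Longrightarrow> module complex_ring (K j)"
  using summand_pre pre_hilbert_space_def by blast

lemma summand_group: "j \<in> J \<Longrightarrow> abelian_group (K j)"
  using summand_module module_def by blast

lemma summand_monoid: "j \<in> J \<Longrightarrow> abelian_monoid (K j)"
  using summand_group abelian_group_def by blast

lemma summand_zero_closed: "j \<in> J \<Longrightarrow> \<zero>\<^bsub>K j\<^esub> \<in> carrier (K j)"
  by (simp add: abelian_monoid.zero_closed summand_monoid)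

lemma summand_add_closed:
  "\<lbrakk>j \<in> J; x \<in> carrier (K j); y \<in> carrier (K j)\<rbrakk> \<Longrightarrow> x \<oplus>\<^bsub>K j\<^esub> y \<in> carrier (K j)"
  by (simp add: abelian_monoid.a_closed summand_monoid)

lemma summand_smult_closed:
  "\<lbrakk>j \<in> J; x \<in> carrier (K j)\<rbrakk> \<Longrightarrow> c \<odot>\<^bsub>K j\<^esub> x \<in> carrier (K j)"
  by (simp add: pre_hilbert_space.smult_carrier summand_pre)

lemmas summand_closed = summand_zero_closed summand_add_closed summand_smult_closed

lemma zero_closed: "\<zero>\<^bsub>H\<^esub> \<in> carrier H"
  by (simp add: zero_eq tuple_closed summand_closed)

lemma add_closed: "\<lbrakk>x \<in> carrier H; y \<in> carrier H\<rbrakk> \<Longrightarrow> x \<oplus>\<^bsub>H\<^esub> y \<in> carrier H"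
  by (simp add: add_eq tuple_closed summand_closed coord_closed)

lemma smult_closed: "x \<in> carrier H \<Longrightarrow> c \<odot>\<^bsub>H\<^esub> x \<in> carrier H"
  by (simp add: smult_eq tuple_closed summand_closed coord_closed)

lemma coord_zero: "j \<in> J \<Longrightarrow> coord j \<zero>\<^bsub>H\<^esub> = \<zero>\<^bsub>K j\<^esub>"
  by (simp add: zero_eq coord_tuple summand_closed)

lemma coord_add:
  "\<lbrakk>j \<in> J; x \<in> carrier H; y \<in> carrier H\<rbrakk> \<Longrightarrow> coord j (x \<oplus>\<^bsub>H\<^esub> y) = coord j x \<oplus>\<^bsub>K j\<^esub> coord j y"
  by (simp add: add_eq coord_tuple summand_closed coord_closed)

lemma coord_smult:
  "\<lbrakk>j \<in> J; x \<in> carrier H\<rbrakk> \<Longrightarrow> coord j (c \<odot>\<^bsub>H\<^esub> x) = c \<odot>\<^bsub>K j\<^esub> coord j x"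
  by (simp add: smult_eq coord_tuple summand_closed coord_closed)

lemmas coord_simps = coord_zero coord_add coord_smult
lemmas closed = zero_closed add_closed smult_closed coord_closed

lemma module_sum: "module complex_ring H"
proof (rule moduleI)
  show "cring complex_ring" by (rule cring_from_type_algebra)
  show "abelian_group H"
  proof (rule abelian_groupI)
    fix x assume x: "x \<in> carrier H"
    have "(- 1) \<odot>\<^bsub>K j\<^esub> coord j x \<oplus>\<^bsub>K j\<^esub> coord j x = \<zero>\<^bsub>K j\<^esub>" if j: "j \<in> J" for j
    proof -
      interpret pre_hilbert_space "K j" using j by (rule summand_pre)
      show ?thesis using x j coord_closed by (simp add: M.l_neg flip: uminus_smult)
    qed
    then have "(- 1) \<odot>\<^bsub>H\<^esub> x \<oplus>\<^bsub>H\<^esub> x = \<zero>\<^bsub>H\<^esub>"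
      using x by (intro coord_eqI) (simp_all add: closed coord_simps)
    then show "\<exists>y\<in>carrier H. y \<oplus>\<^bsub>H\<^esub> x = \<zero>\<^bsub>H\<^esub>" using x smult_closed by blast
  qed (auto intro!: coord_eqI simp: closed coord_simps abelian_monoid.a_assoc[OF summand_monoid]
      abelian_monoid.a_comm[OF summand_monoid] abelian_monoid.l_zero[OF summand_monoid])
qed (auto intro!: coord_eqI simp: closed coord_simps module.smult_l_distr[OF summand_module]
      module.smult_r_distr[OF summand_module] module.smult_assoc1[OF summand_module]
      module.smult_one[OF summand_module])

lemma pre_hilbert_sum: "pre_hilbert_space H"
proof (intro pre_hilbert_space.intro pre_hilbert_space_axioms.intro module_sum)
  fix x y z c
  assume x: "x \<in> carrier H" and y: "y \<in> carrier H"
  show "ip H y x = cnj (ip H x y)"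
    using x y by (simp add: ip_eq closed pre_hilbert_space.ip_commute[OF summand_pre, symmetric]
        cong: sum.cong)
  show "ip H (c \<odot>\<^bsub>H\<^esub> x) y = c * ip H x y"
    using x y by (simp add: ip_eq closed coord_simps pre_hilbert_space.ip_smult_left[OF summand_pre]
        sum_distrib_left cong: sum.cong)
  assume z: "z \<in> carrier H"
  show "ip H (x \<oplus>\<^bsub>H\<^esub> y) z = ip H x z + ip H y z"
    using x y z by (simp add: ip_eq closed coord_simps pre_hilbert_space.ip_add_left[OF summand_pre]
        sum.distrib cong: sum.cong)
next
  fix x
  assume x: "x \<in> carrier H"
  have nonneg: "0 \<le> Re (ip (K j) (coord j x) (coord j x))" if "j \<in> J" for j
    using x that by (simp add: closed pre_hilbert_space.ip_nonneg[OF summand_pre])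
  show "0 \<le> Re (ip H x x)"
    using x nonneg by (simp add: ip_eq sum_nonneg)
  assume "ip H x x = 0"
  then have "(\<Sum>j\<in>J. Re (ip (K j) (coord j x) (coord j x))) = 0"
    using x by (simp add: ip_eq flip: Re_sum)
  then have "Re (ip (K j) (coord j x) (coord j x)) = 0" if "j \<in> J" for j
    using nonneg finite_index that by (simp add: sum_nonneg_eq_0_iff)
  then have "coord j x = \<zero>\<^bsub>K j\<^esub>" if "j \<in> J" for j
    using x that pre_hilbert_space.hnorm_zero_iff[OF summand_pre, of j "coord j x"]
    by (simp add: closed hnorm_def)
  then show "x = \<zero>\<^bsub>H\<^esub>"
    using x by (intro coord_eqI) (simp_all add: closed coord_simps)
qed

sublocale pre_hilbert_space H by (rule pre_hilbert_sum)

lemma hnorm_eq_L2_set: "x \<in> carrier H \<Longrightarrow> hnorm H x = L2_set (\<lambda>j. hnorm (K j) (coord j x)) J"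
  unfolding L2_set_def hnorm_def[of H]
  by (simp add: ip_eq closed pre_hilbert_space.hnorm_square[OF summand_pre] cong: sum.cong)

lemma hnorm_coord_le:
  "\<lbrakk>j \<in> J; x \<in> carrier H\<rbrakk> \<Longrightarrow> hnorm (K j) (coord j x) \<le> hnorm H x"
  using member_le_L2_set[OF finite_index, of j "\<lambda>j. hnorm (K j) (coord j x)"]
  by (simp add: hnorm_eq_L2_set)

lemma hnorm_le_sum: "x \<in> carrier H \<Longrightarrow> hnorm H x \<le> (\<Sum>j\<in>J. hnorm (K j) (coord j x))"
  unfolding hnorm_eq_L2_set
  by (rule L2_set_le_sum) (simp add: closed pre_hilbert_space.hnorm_nonneg[OF summand_pre])

lemma coord_op: "j \<in> J \<Longrightarrow> (\<lambda>z \<in> carrier H. coord j z) \<in> bounded_ops H (K j)"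
  by (auto simp: bounded_ops_def closed coord_simps hnorm_coord_le intro!: exI[of _ 1])

lemma pre_hilbert_pair_coord: "j \<in> J \<Longrightarrow> pre_hilbert_pair H (K j)"
  by (simp add: pre_hilbert_pair.intro pre_hilbert_sum summand_pre)

lemma hdist_le_sum:
  assumes "x \<in> carrier H" "y \<in> carrier H"
  shows "hdist H x y \<le> (\<Sum>j\<in>J. hdist (K j) (coord j x) (coord j y))"
proof -
  have "coord j (x \<ominus> y) = coord j x \<ominus>\<^bsub>K j\<^esub> coord j y" if j: "j \<in> J" for j
    using pre_hilbert_pair.op_minus[OF pre_hilbert_pair_coord[OF j] coord_op[OF j]] assms by simp
  then show ?thesis
    using hnorm_le_sum[of "x \<ominus> y"] assms by (simp add: hdist_def closed)
qed

text \<open>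
  A Cauchy sequence has Cauchy coordinates, because coordinates are contractions. The tuple of their
  limits is the limit of the sequence, since the distance in the sum is at most the sum of the
  finitely many distances of coordinates.
\<close>

lemma hilbert_sum: "hilbert_space H"
proof (intro hilbert_space.intro hilbert_space_axioms.intro pre_hilbert_sum)
  interpret MH: Metric_space "carrier H" "hdist H" by (rule Metric_space_hdist)
  have metric: "Metric_space (carrier (K j)) (hdist (K j))" if "j \<in> J" for j
    using that by (simp add: pre_hilbert_space.Metric_space_hdist summand_pre)
  show "MH.mcomplete"
    unfolding MH.mcomplete_def
  proof (intro allI impI)
    fix \<sigma> assume \<sigma>: "MH.MCauchy \<sigma>"
    then have in_H: "\<sigma> n \<in> carrier H" for n by (auto simp: MH.MCauchy_def)
    have "\<exists>l. limitin (Metric_space.mtopology (carrier (K j)) (hdist (K j))) (\<lambda>n. coord j (\<sigma> n)) l sequentially"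
      if j: "j \<in> J" for j
    proof -
      interpret Metric_space "carrier (K j)" "hdist (K j)" using metric[OF j] .
      have "MCauchy ((\<lambda>z \<in> carrier H. coord j z) \<circ> \<sigma>)"
        using Lipschitz_imp_Cauchy_continuous_map[OF
            pre_hilbert_pair.op_Lipschitz[OF pre_hilbert_pair_coord[OF j] coord_op[OF j]]] \<sigma>
        by (simp add: Cauchy_continuous_map_def)
      moreover have "(\<lambda>z \<in> carrier H. coord j z) \<circ> \<sigma> = (\<lambda>n. coord j (\<sigma> n))"
        using in_H by auto
      ultimately show ?thesis
        using hilbert_space.complete[OF summand[OF j]] by (simp add: mcomplete_def)
    qed
    then obtain l where l: "\<And>j. j \<in> J \<Longrightarrow>
        limitin (Metric_space.mtopology (carrier (K j)) (hdist (K j))) (\<lambda>n. coord j (\<sigma> n)) (l j) sequentially"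
      by metis
    have l_in: "l j \<in> carrier (K j)" and lim: "(\<lambda>n. hdist (K j) (coord j (\<sigma> n)) (l j)) \<longlonglongrightarrow> 0"
      if "j \<in> J" for j
      using l[OF that] unfolding Metric_space.limitin_metric_dist_null[OF metric[OF that]] by auto
    have tl: "tuple l \<in> carrier H" using l_in by (rule tuple_closed)
    have "(\<lambda>n. hdist H (\<sigma> n) (tuple l)) \<longlonglongrightarrow> 0"
    proof (rule tendsto_sandwich[where f = "\<lambda>_. 0"])
      show "(\<lambda>n. \<Sum>j\<in>J. hdist (K j) (coord j (\<sigma> n)) (l j)) \<longlonglongrightarrow> 0"
        using lim by (rule tendsto_null_sum)
      show "\<forall>\<^sub>F n in sequentially. hdist H (\<sigma> n) (tuple l) \<le> (\<Sum>j\<in>J. hdist (K j) (coord j (\<sigma> n)) (l j))"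
        using hdist_le_sum[OF in_H tl] l_in by (simp add: coord_tuple cong: sum.cong)
    qed simp_all
    then show "\<exists>x. limitin MH.mtopology \<sigma> x sequentially"
      using tl in_H by (auto simp: MH.limitin_metric_dist_null)
  qed
qed

definition embed :: "'j \<Rightarrow> 'a \<Rightarrow> 'b" where
  "embed j = (\<lambda>x \<in> carrier (K j). tuple (\<lambda>i. if i = j then x else \<zero>\<^bsub>K i\<^esub>))"

lemma embed_closed: "\<lbrakk>j \<in> J; x \<in> carrier (K j)\<rbrakk> \<Longrightarrow> embed j x \<in> carrier H"
  by (auto simp: embed_def summand_closed intro: tuple_closed)

lemma coord_embed:
  "\<lbrakk>i \<in> J; j \<in> J; x \<in> carrier (K j)\<rbrakk> \<Longrightarrow> coord i (embed j x) = (if i = j then x else \<zero>\<^bsub>K i\<^esub>)"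
  by (simp add: embed_def summand_closed coord_tuple)

lemma embed_op:
  assumes j: "j \<in> J" shows "embed j \<in> bounded_ops (K j) H"
proof -
  interpret Kj: pre_hilbert_space "K j" using j by (rule summand_pre)
  have "embed j (x \<oplus>\<^bsub>K j\<^esub> y) = embed j x \<oplus> embed j y" if "x \<in> carrier (K j)" "y \<in> carrier (K j)" for x y
    using j that
    by (intro coord_eqI) (auto simp: embed_closed closed coord_simps coord_embed
        abelian_monoid.l_zero[OF summand_monoid] summand_closed)
  moreover have "embed j (c \<odot>\<^bsub>K j\<^esub> x) = c \<odot> embed j x" if "x \<in> carrier (K j)" for c x
    using j that
    by (intro coord_eqI) (auto simp: embed_closed closed coord_simps coord_embed
        pre_hilbert_space.smult_zero_right[OF summand_pre])
  moreover have "hnorm H (embed j x) \<le> hnorm (K j) x" if "x \<in> carrier (K j)" for x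
  proof -
    have "hnorm H (embed j x) \<le> (\<Sum>i\<in>J. hnorm (K i) (coord i (embed j x)))"
      using j that by (intro hnorm_le_sum embed_closed)
    also have "\<dots> = (\<Sum>i\<in>J. if i = j then hnorm (K j) x else 0)"
      using j that
      by (intro sum.cong) (auto simp: coord_embed pre_hilbert_space.hnorm_zero[OF summand_pre])
    also have "\<dots> = hnorm (K j) x" using j finite_index by simp
    finally show ?thesis .
  qed
  then have "\<exists>C. \<forall>x \<in> carrier (K j). hnorm H (embed j x) \<le> C * hnorm (K j) x"
    by (intro exI[of _ 1]) simp
  moreover have "embed j \<in> carrier (K j) \<rightarrow>\<^sub>E carrier H"
    using j embed_closed by (auto simp: embed_def)
  ultimately show ?thesis by (simp add: bounded_ops_def)
qed

definition diagonal :: "('j \<Rightarrow> 'a \<Rightarrow> 'a) \<Rightarrow> 'b \<Rightarrow> 'b" where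
  "diagonal T = (\<lambda>z \<in> carrier H. tuple (\<lambda>j. T j (coord j z)))"

context
  fixes T :: "'j \<Rightarrow> 'a \<Rightarrow> 'a"
  assumes T: "\<And>j. j \<in> J \<Longrightarrow> T j \<in> bounded_ops (K j) (K j)"
begin

lemma diag_entry_closed: "\<lbrakk>j \<in> J; z \<in> carrier H\<rbrakk> \<Longrightarrow> T j (coord j z) \<in> carrier (K j)"
  using T[of j] coord_closed[of j z] by (auto simp: bounded_ops_def)

lemma diagonal_closed: "z \<in> carrier H \<Longrightarrow> diagonal T z \<in> carrier H"
  by (simp add: diagonal_def diag_entry_closed tuple_closed)

lemma coord_diagonal: "\<lbrakk>j \<in> J; z \<in> carrier H\<rbrakk> \<Longrightarrow> coord j (diagonal T z) = T j (coord j z)"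
  by (simp add: diagonal_def diag_entry_closed coord_tuple)

lemma diagonal_op: "diagonal T \<in> bounded_ops H H"
proof -
  have pair: "pre_hilbert_pair (K j) (K j)" if "j \<in> J" for j
    using that by (simp add: pre_hilbert_pair.intro summand_pre)
  have "\<exists>C\<ge>0. \<forall>x \<in> carrier (K j). hnorm (K j) (T j x) \<le> C * hnorm (K j) x" if "j \<in> J" for j
    using pre_hilbert_pair.op_bound[OF pair T, OF that that] by metis
  then obtain C where C: "\<And>j. j \<in> J \<Longrightarrow> 0 \<le> C j"
      "\<And>j x. \<lbrakk>j \<in> J; x \<in> carrier (K j)\<rbrakk> \<Longrightarrow> hnorm (K j) (T j x) \<le> C j * hnorm (K j) x"
    by metis
  have "hnorm H (diagonal T z) \<le> (\<Sum>j\<in>J. C j) * hnorm H z" if z: "z \<in> carrier H" for z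
  proof -
    have "hnorm H (diagonal T z) \<le> (\<Sum>j\<in>J. hnorm (K j) (T j (coord j z)))"
      using hnorm_le_sum[OF diagonal_closed[OF z]] z by (simp add: coord_diagonal cong: sum.cong)
    also have "\<dots> \<le> (\<Sum>j\<in>J. C j * hnorm H z)"
    proof (rule sum_mono)
      fix j assume j: "j \<in> J"
      have "hnorm (K j) (T j (coord j z)) \<le> C j * hnorm (K j) (coord j z)"
        using C(2) j z by (simp add: closed)
      also have "\<dots> \<le> C j * hnorm H z"
        using C(1) j z by (simp add: hnorm_coord_le mult_left_mono)
      finally show "hnorm (K j) (T j (coord j z)) \<le> C j * hnorm H z" .
    qed
    finally show ?thesis by (simp add: sum_distrib_right)
  qed
  moreover have "diagonal T (x \<oplus> y) = diagonal T x \<oplus> diagonal T y" if "x \<in> carrier H" "y \<in> carrier H" for x y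
    using that by (intro coord_eqI) (simp_all add: closed coord_simps diagonal_closed coord_diagonal
        pre_hilbert_pair.op_add[OF pair T])
  moreover have "diagonal T (c \<odot> x) = c \<odot> diagonal T x" if "x \<in> carrier H" for c x
    using that by (intro coord_eqI) (simp_all add: closed coord_simps diagonal_closed coord_diagonal
        pre_hilbert_pair.op_smult[OF pair T])
  ultimately show ?thesis
    using diagonal_closed by (auto simp: bounded_ops_def PiE_iff extensional_def diagonal_def)
qed

end

text \<open>
  The tuple of the \<open>T j (coord j z)\<close> is well-formed because these are the coordinates of the
  vector \<open>\<psi> z\<close>; and a vector is determined by its coordinates.
\<close>

lemma diagonal_eq_restrictI:
  assumes closed_\<psi>: "\<And>z. z \<in> carrier H \<Longrightarrow> \<psi> z \<in> carrier H"
    and coord_\<psi>: "\<And>j z. \<lbrakk>j \<in> J; z \<in> carrier H\<rbrakk> \<Longrightarrow> coord j (\<psi> z) = T j (coord j z)"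
  shows "diagonal T = (\<lambda>z \<in> carrier H. \<psi> z)"
proof -
  have "tuple (\<lambda>j. T j (coord j z)) = \<psi> z" if z: "z \<in> carrier H" for z
  proof -
    have "T j (coord j z) \<in> carrier (K j)" if "j \<in> J" for j
      using coord_closed[OF that closed_\<psi>[OF z]] coord_\<psi>[OF that z] by simp
    then show ?thesis
      using z by (intro coord_eqI tuple_closed) (simp_all add: closed_\<psi> coord_\<psi> coord_tuple)
  qed
  then show ?thesis by (auto simp: diagonal_def)
qed

text \<open>
  The coordinate map to \<open>K j\<close> is onto, so if \<open>\<phi>\<close> preserves its kernel, then \<open>\<phi>\<close> induces an operator
  on \<open>K j\<close>. Boundedness of the induced operator is clear from its description by the section
  \<open>embed j\<close> of the coordinate map: embed, apply \<open>\<phi>\<close>, and take the coordinate.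
\<close>

lemma diagonal_if_preserves_kernels:
  assumes \<phi>: "\<phi> \<in> bounded_ops H H"
    and ker: "\<And>j z. \<lbrakk>j \<in> J; z \<in> carrier H; coord j z = \<zero>\<^bsub>K j\<^esub>\<rbrakk> \<Longrightarrow> coord j (\<phi> z) = \<zero>\<^bsub>K j\<^esub>"
  obtains T where "\<And>j. j \<in> J \<Longrightarrow> T j \<in> bounded_ops (K j) (K j)" "\<phi> = diagonal T"
proof -
  interpret HH: pre_hilbert_pair H H by (intro pre_hilbert_pair.intro pre_hilbert_sum)
  define T where "T j = compose (carrier (K j)) (compose (carrier H) (\<lambda>z \<in> carrier H. coord j z) \<phi>) (embed j)" for j
  have T_op: "T j \<in> bounded_ops (K j) (K j)" if "j \<in> J" for j
    unfolding T_def using that \<phi>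
    by (intro compose_bounded_ops[of _ H] summand_pre pre_hilbert_sum coord_op embed_op)
  have T_eq: "T j x = coord j (\<phi> (embed j x))" if "j \<in> J" "x \<in> carrier (K j)" for j x
    using that \<phi> by (simp add: T_def compose_eq embed_closed HH.op_closed)
  have "coord j (\<phi> z) = T j (coord j z)" if j: "j \<in> J" and z: "z \<in> carrier H" for j z
  proof -
    interpret Hj: pre_hilbert_pair H "K j" using j by (rule pre_hilbert_pair_coord)
    let ?w = "embed j (coord j z)"
    have w: "?w \<in> carrier H" using j z by (simp add: embed_closed closed)
    have sub: "coord j (x \<ominus> y) = coord j x \<ominus>\<^bsub>K j\<^esub> coord j y"
      if "x \<in> carrier H" "y \<in> carrier H" for x y
      using Hj.op_minus[OF coord_op[OF j] that] that by simp
    \<comment> \<open>The vectors \<open>z\<close> and \<open>?w\<close> differ by an element of the kernel, hence so do their images.\<close>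
    have "coord j (z \<ominus> ?w) = \<zero>\<^bsub>K j\<^esub>"
      using sub[OF z w] j z by (simp add: coord_embed closed Hj.K.minus_eq_zero_iff)
    then have "coord j (\<phi> (z \<ominus> ?w)) = \<zero>\<^bsub>K j\<^esub>" using ker j z w by simp
    then have "coord j (\<phi> z) \<ominus>\<^bsub>K j\<^esub> coord j (\<phi> ?w) = \<zero>\<^bsub>K j\<^esub>"
      using \<phi> z w by (simp add: HH.op_minus HH.op_closed sub)
    then have "coord j (\<phi> z) = coord j (\<phi> ?w)"
      using \<phi> j z w by (simp add: Hj.K.minus_eq_zero_iff HH.op_closed closed)
    then show ?thesis using j z by (simp add: T_eq closed)
  qed
  then have "\<phi> = diagonal T"
    using T_op \<phi>
    by (intro HH.op_eqI diagonal_op coord_eqI) (simp_all add: HH.op_closed diagonal_closed coord_diagonal)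
  with T_op show ?thesis by (rule that)
qed

lemma closed_subspace_kernel:
  assumes "j \<in> J"
  shows "closed_subspace {z \<in> carrier H. coord j z = \<zero>\<^bsub>K j\<^esub>} H"
proof -
  interpret pre_hilbert_pair H "K j" using assms by (rule pre_hilbert_pair_coord)
  from closed_subspace_equalizer[OF coord_op[OF assms] zero_op]
  show ?thesis by (simp cong: conj_cong)
qed

lemma closed_subspace_graph:
  assumes i: "i \<in> J" and j: "j \<in> J" and a: "a \<in> bounded_ops (K i) (K j)"
  shows "closed_subspace {z \<in> carrier H. coord j z = a (coord i z)} H"
proof -
  interpret pre_hilbert_pair H "K j" using j by (rule pre_hilbert_pair_coord)
  from closed_subspace_equalizer[OF coord_op[OF j]
      compose_bounded_ops[OF pre_hilbert_sum summand_pre summand_pre, OF i j a coord_op[OF i]]]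
  show ?thesis by (simp add: compose_eq cong: conj_cong)
qed

text \<open>
  Since \<open>i\<close> and \<open>j\<close> are different coordinates, every \<open>x\<close> in \<open>K i\<close> occurs as the \<open>i\<close>-th coordinate of
  a vector in the subspace, namely one with \<open>a x\<close> as the \<open>j\<close>-th coordinate. All the other coordinates
  are unconstrained, and a diagonal operator does not mix them in.
\<close>

lemma diagonal_preserves_graph_iff:
  assumes T: "\<And>k. k \<in> J \<Longrightarrow> T k \<in> bounded_ops (K k) (K k)"
    and i: "i \<in> J" and j: "j \<in> J" and ij: "i \<noteq> j" and a: "a \<in> bounded_ops (K i) (K j)"
  shows "diagonal T ` {z \<in> carrier H. coord j z = a (coord i z)} \<subseteq> {z \<in> carrier H. coord j z = a (coord i z)}
    \<longleftrightarrow> (\<forall>x \<in> carrier (K i). T j (a x) = a (T i x))"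
proof
  assume L: "diagonal T ` {z \<in> carrier H. coord j z = a (coord i z)} \<subseteq> {z \<in> carrier H. coord j z = a (coord i z)}"
  show "\<forall>x \<in> carrier (K i). T j (a x) = a (T i x)"
  proof
    fix x assume x: "x \<in> carrier (K i)"
    have ax: "a x \<in> carrier (K j)" using a x by (auto simp: bounded_ops_def)
    let ?k = "\<lambda>k. if k = i then x else if k = j then a x else \<zero>\<^bsub>K k\<^esub>"
    have k: "?k k \<in> carrier (K k)" if "k \<in> J" for k
      using that x ax by (simp add: summand_closed)
    define z where "z = tuple ?k"
    have z: "z \<in> carrier H" unfolding z_def using k by (rule tuple_closed)
    have c: "coord i z = x" "coord j z = a x"
      using coord_tuple[of ?k, OF k i] coord_tuple[of ?k, OF k j] ij by (simp_all add: z_def)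
    have "diagonal T z \<in> diagonal T ` {z \<in> carrier H. coord j z = a (coord i z)}"
      using z c by (intro imageI) simp
    with L have "coord j (diagonal T z) = a (coord i (diagonal T z))"
      by (auto dest: subsetD)
    then show "T j (a x) = a (T i x)"
      using z c i j T by (simp add: coord_diagonal)
  qed
next
  assume "\<forall>x \<in> carrier (K i). T j (a x) = a (T i x)"
  then show "diagonal T ` {z \<in> carrier H. coord j z = a (coord i z)} \<subseteq> {z \<in> carrier H. coord j z = a (coord i z)}"
    using i j T by (auto simp: diagonal_closed coord_diagonal closed)
qed

lemma diagonal_preserves_kernel:
  assumes T: "\<And>k. k \<in> J \<Longrightarrow> T k \<in> bounded_ops (K k) (K k)" and j: "j \<in> J"
  shows "diagonal T ` {z \<in> carrier H. coord j z = \<zero>\<^bsub>K j\<^esub>} \<subseteq> {z \<in> carrier H. coord j z = \<zero>\<^bsub>K j\<^esub>}"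
proof -
  have "T j \<zero>\<^bsub>K j\<^esub> = \<zero>\<^bsub>K j\<^esub>"
    using pre_hilbert_pair.op_zero[OF pre_hilbert_pair.intro[OF summand_pre[OF j] summand_pre[OF j]] T[OF j]] .
  then show ?thesis using T j by (auto simp: diagonal_closed coord_diagonal)
qed

end

section \<open>Doubling a quiver representation\<close>

primrec vertex :: "'v + 'v \<Rightarrow> 'v" where
  "vertex (Inl v) = v"
| "vertex (Inr v) = v"

primrec component :: "'v + 'v \<Rightarrow> ('v, 'a) double_sum \<Rightarrow> 'a" where
  "component (Inl v) z = fst z v"
| "component (Inr v) z = snd z v"

text \<open>
  Indices in \<open>V <+> V\<close> address both copies of a family over \<open>V\<close> at once: \<open>Inl v\<close> is the coordinate
  at \<open>v\<close> in the first copy, \<open>Inr v\<close> the one in the second copy.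
\<close>

definition of_components :: "'v set \<Rightarrow> ('v + 'v \<Rightarrow> 'a) \<Rightarrow> ('v, 'a) double_sum" where
  "of_components V k = (\<lambda>v \<in> V. k (Inl v), \<lambda>v \<in> V. k (Inr v))"

definition double_sum :: "'v set \<Rightarrow> ('v \<Rightarrow> 'a hilbert) \<Rightarrow> ('v, 'a) double_sum hilbert" where
  "double_sum V K = \<lparr>carrier = (\<Pi>\<^sub>E v \<in> V. carrier (K v)) \<times> (\<Pi>\<^sub>E v \<in> V. carrier (K v)),
    monoid.mult = undefined,
    one = undefined,
    zero = of_components V (\<lambda>j. \<zero>\<^bsub>K (vertex j)\<^esub>),
    add = (\<lambda>x y. of_components V (\<lambda>j. component j x \<oplus>\<^bsub>K (vertex j)\<^esub> component j y)),
    module.smult = (\<lambda>c x. of_components V (\<lambda>j. c \<odot>\<^bsub>K (vertex j)\<^esub> component j x)),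
    ip = (\<lambda>x y. \<Sum>j \<in> V <+> V. ip (K (vertex j)) (component j x) (component j y))\<rparr>"

lemma orthogonal_sum_double_sum:
  fixes V :: "'v set" and K :: "'v \<Rightarrow> 'a hilbert"
  assumes "finite V" and "\<And>v. v \<in> V \<Longrightarrow> hilbert_space (K v)"
  shows "orthogonal_sum (V <+> V) (\<lambda>j. K (vertex j)) (double_sum V K) component (of_components V)"
proof (rule orthogonal_sum.intro)
  fix x y :: "('v, 'a) double_sum"
  assume x: "x \<in> carrier (double_sum V K)" and y: "y \<in> carrier (double_sum V K)"
    and eq: "\<And>j. j \<in> V <+> V \<Longrightarrow> component j x = component j y"
  have "fst x v = fst y v" "snd x v = snd y v" if "v \<in> V" for v
    using eq[of "Inl v"] eq[of "Inr v"] that by auto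
  moreover have "fst x \<in> extensional V" "fst y \<in> extensional V" "snd x \<in> extensional V" "snd y \<in> extensional V"
    using x y by (auto simp: double_sum_def PiE_iff)
  ultimately show "x = y"
    by (intro prod_eqI extensionalityI[where A = V]) auto
next
  fix k :: "'v + 'v \<Rightarrow> 'a"
  assume "\<And>j. j \<in> V <+> V \<Longrightarrow> k j \<in> carrier (K (vertex j))"
  from this[of "Inl _"] this[of "Inr _"] show "of_components V k \<in> carrier (double_sum V K)"
    by (auto simp: double_sum_def of_components_def)
qed (use assms in \<open>auto simp: double_sum_def of_components_def PiE_iff\<close>)

locale finite_hilbert_representation = fin_digraph \<Gamma> + hilbert_representation \<Gamma> K f
  for \<Gamma> :: "('v, 'e) pre_digraph" (structure) and K :: "'v \<Rightarrow> 'a hilbert" and f :: "'e \<Rightarrow> 'a \<Rightarrow> 'a"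
begin

abbreviation "V \<equiv> verts \<Gamma>"
abbreviation "H \<equiv> double_sum V K"

sublocale orth: orthogonal_sum "V <+> V" "\<lambda>j. K (vertex j)" H component "of_components V"
  by (rule orthogonal_sum_double_sum) (simp_all add: space)

definition kernel :: "'v + 'v \<Rightarrow> ('v, 'a) double_sum set" where
  "kernel j = {z \<in> carrier H. component j z = \<zero>\<^bsub>K (vertex j)\<^esub>}"

text \<open>
  Unlike the graph of \<open>a\<close> proper, this subspace leaves all coordinates other than the two involved
  free. It has the same diagonal endomorphisms and is described by a single equation.
\<close>

definition graph :: "'v \<Rightarrow> 'v \<Rightarrow> ('a \<Rightarrow> 'a) \<Rightarrow> ('v, 'a) double_sum set" where
  "graph v w a = {z \<in> carrier H. component (Inr w) z = a (component (Inl v) z)}"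

definition subspaces :: "('v, 'a) double_sum set set" where
  "subspaces = kernel ` (V <+> V) \<union> (\<lambda>v. graph v v (\<lambda>x \<in> carrier (K v). x)) ` V
    \<union> (\<lambda>\<alpha>. graph (tail \<Gamma> \<alpha>) (head \<Gamma> \<alpha>) (f \<alpha>)) ` arcs \<Gamma>"

lemma finite_subspaces: "finite subspaces"
  by (simp add: subspaces_def)

lemma vertex_in: "j \<in> V <+> V \<Longrightarrow> vertex j \<in> V"
  by auto

lemma pre_space: "v \<in> V \<Longrightarrow> pre_hilbert_space (K v)"
  using space hilbert_space_def by blast

lemma id_op: "v \<in> V \<Longrightarrow> (\<lambda>x \<in> carrier (K v). x) \<in> bounded_ops (K v) (K v)"
  using orth.summand_closed[of "Inl v"] by (auto simp: bounded_ops_def intro!: exI[of _ 1])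

lemma closed_subspace_graph:
  "\<lbrakk>v \<in> V; w \<in> V; a \<in> bounded_ops (K v) (K w)\<rbrakk> \<Longrightarrow> closed_subspace (graph v w a) H"
  using orth.closed_subspace_graph[of "Inl v" "Inr w" a] by (simp add: graph_def InlI InrI)

lemma closed_subspaces: "F \<in> subspaces \<Longrightarrow> closed_subspace F H"
  by (auto simp: subspaces_def kernel_def id_op operator
      intro!: orth.closed_subspace_kernel closed_subspace_graph)

definition double :: "('v \<Rightarrow> 'a \<Rightarrow> 'a) \<Rightarrow> ('v, 'a) double_sum \<Rightarrow> ('v, 'a) double_sum" where
  "double T = orth.diagonal (\<lambda>j. T (vertex j))"

lemma double_preserves_graph_iff:
  assumes "\<And>v. v \<in> V \<Longrightarrow> T v \<in> bounded_ops (K v) (K v)"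
    and "v \<in> V" "w \<in> V" "a \<in> bounded_ops (K v) (K w)"
  shows "double T ` graph v w a \<subseteq> graph v w a \<longleftrightarrow> (\<forall>x \<in> carrier (K v). T w (a x) = a (T v x))"
proof -
  have "T (vertex j) \<in> bounded_ops (K (vertex j)) (K (vertex j))" if "j \<in> V <+> V" for j
    using assms(1) that by auto
  from orth.diagonal_preserves_graph_iff[OF this, of "Inl v" "Inr w" a] assms(2-)
  show ?thesis by (simp add: graph_def double_def InlI InrI)
qed

lemma End_repD:
  assumes "T \<in> carrier (End_rep \<Gamma> K f)"
  shows "T \<in> (\<Pi>\<^sub>E v \<in> V. bounded_ops (K v) (K v))"
    and "\<lbrakk>\<alpha> \<in> arcs \<Gamma>; x \<in> carrier (K (tail \<Gamma> \<alpha>))\<rbrakk> \<Longrightarrow> T (head \<Gamma> \<alpha>) (f \<alpha> x) = f \<alpha> (T (tail \<Gamma> \<alpha>) x)"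
  using assms by (auto simp: End_rep_def)

lemma End_rep_op: "\<lbrakk>T \<in> carrier (End_rep \<Gamma> K f); v \<in> V\<rbrakk> \<Longrightarrow> T v \<in> bounded_ops (K v) (K v)"
  using End_repD(1) by (auto simp: PiE_iff)

lemma op_apply_closed:
  "\<lbrakk>T v \<in> bounded_ops (K v) (K v); x \<in> carrier (K v)\<rbrakk> \<Longrightarrow> T v x \<in> carrier (K v)"
  by (auto simp: bounded_ops_def)

lemma double_preserves_subspaces:
  assumes T: "T \<in> carrier (End_rep \<Gamma> K f)" and F: "F \<in> subspaces"
  shows "double T ` F \<subseteq> F"
proof -
  note T_op = End_rep_op[OF T]
  have "double T ` kernel j \<subseteq> kernel j" if "j \<in> V <+> V" for j
    unfolding kernel_def double_def using that T_op by (intro orth.diagonal_preserves_kernel) auto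
  moreover have "double T ` graph v v (\<lambda>x \<in> carrier (K v). x) \<subseteq> graph v v (\<lambda>x \<in> carrier (K v). x)" if "v \<in> V" for v
    using that T_op op_apply_closed[of T v] by (simp add: double_preserves_graph_iff id_op)
  moreover have "double T ` graph (tail \<Gamma> \<alpha>) (head \<Gamma> \<alpha>) (f \<alpha>) \<subseteq> graph (tail \<Gamma> \<alpha>) (head \<Gamma> \<alpha>) (f \<alpha>)"
    if "\<alpha> \<in> arcs \<Gamma>" for \<alpha>
    using that T_op End_repD(2)[OF T that] by (simp add: double_preserves_graph_iff operator)
  ultimately show ?thesis
    using F unfolding subspaces_def by (elim UnE imageE) (simp_all only:)
qed

text \<open>
  The kernels make \<open>\<phi>\<close> diagonal with entries \<open>S (Inl v)\<close> and \<open>S (Inr v)\<close>, the graphs of identities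
  make the two entries at each vertex equal, and the graphs of the \<open>f \<alpha>\<close> make them intertwine.
\<close>

lemma double_surj:
  assumes \<phi>: "\<phi> \<in> bounded_ops H H" and pres: "\<And>F. F \<in> subspaces \<Longrightarrow> \<phi> ` F \<subseteq> F"
  shows "\<phi> \<in> double ` carrier (End_rep \<Gamma> K f)"
proof -
  have "component j (\<phi> z) = \<zero>\<^bsub>K (vertex j)\<^esub>"
    if "j \<in> V <+> V" "z \<in> carrier H" "component j z = \<zero>\<^bsub>K (vertex j)\<^esub>" for j z
    using pres[of "kernel j"] that by (auto simp: subspaces_def kernel_def)
  from orth.diagonal_if_preserves_kernels[OF \<phi> this] obtain S
    where S: "\<And>j. j \<in> V <+> V \<Longrightarrow> S j \<in> bounded_ops (K (vertex j)) (K (vertex j))"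
      and \<phi>_eq: "\<phi> = orth.diagonal S" by blast
  have graph: "S (Inr w) (a x) = a (S (Inl v) x)"
    if "v \<in> V" "w \<in> V" "a \<in> bounded_ops (K v) (K w)" "graph v w a \<in> subspaces" "x \<in> carrier (K v)" for v w a x
    using orth.diagonal_preserves_graph_iff[OF S, of "Inl v" "Inr w" a] pres[of "graph v w a"] that
    by (auto simp: graph_def \<phi>_eq)
  have SI: "S (Inl v) \<in> bounded_ops (K v) (K v)" "S (Inr v) \<in> bounded_ops (K v) (K v)" if "v \<in> V" for v
    using S[of "Inl v"] S[of "Inr v"] that by auto
  have agree: "S (Inr v) = S (Inl v)" if v: "v \<in> V" for v
  proof (rule pre_hilbert_pair.op_eqI[of "K v" "K v"])
    show "pre_hilbert_pair (K v) (K v)" using v by (simp add: pre_hilbert_pair.intro pre_space)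
    fix x assume x: "x \<in> carrier (K v)"
    then show "S (Inr v) x = S (Inl v) x"
      using graph[of v v "\<lambda>x \<in> carrier (K v). x" x] v SI[OF v] op_apply_closed[of "\<lambda>v. S (Inl v)" v x]
      by (auto simp: id_op subspaces_def)
  qed (use SI[OF v] in auto)
  define T where "T = (\<lambda>v \<in> V. S (Inl v))"
  have T_S: "T (vertex j) = S j" if "j \<in> V <+> V" for j
    using that agree by (auto simp: T_def)
  have "T (head \<Gamma> \<alpha>) (f \<alpha> x) = f \<alpha> (T (tail \<Gamma> \<alpha>) x)"
    if "\<alpha> \<in> arcs \<Gamma>" "x \<in> carrier (K (tail \<Gamma> \<alpha>))" for \<alpha> x
    using graph[of "tail \<Gamma> \<alpha>" "head \<Gamma> \<alpha>" "f \<alpha>" x] that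
    by (auto simp: T_def agree operator subspaces_def)
  then have "T \<in> carrier (End_rep \<Gamma> K f)"
    using SI by (auto simp: End_rep_def T_def)
  moreover have "\<phi> = double T"
  proof -
    have "of_components V (\<lambda>j. S j (component j z)) = of_components V (\<lambda>j. T (vertex j) (component j z))" for z
      using agree by (simp add: of_components_def T_def cong: restrict_cong)
    then show ?thesis by (simp add: \<phi>_eq double_def orth.diagonal_def)
  qed
  ultimately show ?thesis by blast
qed

lemma double_op: "T \<in> carrier (End_rep \<Gamma> K f) \<Longrightarrow> double T \<in> bounded_ops H H"
  unfolding double_def using End_rep_op by (intro orth.diagonal_op) auto

lemma double_closed:
  "\<lbrakk>T \<in> carrier (End_rep \<Gamma> K f); z \<in> carrier H\<rbrakk> \<Longrightarrow> double T z \<in> carrier H"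
  unfolding double_def using End_rep_op by (intro orth.diagonal_closed) auto

lemma component_double:
  "\<lbrakk>T \<in> carrier (End_rep \<Gamma> K f); j \<in> V <+> V; z \<in> carrier H\<rbrakk>
    \<Longrightarrow> component j (double T z) = T (vertex j) (component j z)"
  unfolding double_def using End_rep_op by (intro orth.coord_diagonal) auto

text \<open>
  The entry at \<open>v\<close> is recovered by applying \<open>double T\<close> to vectors supported at \<open>v\<close>.
\<close>

lemma inj_double: "inj_on double (carrier (End_rep \<Gamma> K f))"
proof (rule inj_onI)
  fix S T assume S: "S \<in> carrier (End_rep \<Gamma> K f)" and T: "T \<in> carrier (End_rep \<Gamma> K f)"
    and eq: "double S = double T"
  have "S v = T v" if v: "v \<in> V" for v
  proof (rule pre_hilbert_pair.op_eqI[of "K v" "K v"])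
    show "pre_hilbert_pair (K v) (K v)" using v by (simp add: pre_hilbert_pair.intro pre_space)
    fix x assume x: "x \<in> carrier (K v)"
    have z: "orth.embed (Inl v) x \<in> carrier H" "component (Inl v) (orth.embed (Inl v) x) = x"
      using v x orth.embed_closed[of "Inl v" x] orth.coord_embed[of "Inl v" "Inl v" x] by auto
    have "component (Inl v) (double S (orth.embed (Inl v) x)) = component (Inl v) (double T (orth.embed (Inl v) x))"
      using eq by simp
    then show "S v x = T v x"
      using component_double[OF S, of "Inl v"] component_double[OF T, of "Inl v"] v z by (auto simp: InlI simp del: component.simps)
  qed (use End_rep_op[OF S v] End_rep_op[OF T v] in auto)
  then show "S = T"
    using End_repD(1)[OF S] End_repD(1)[OF T] by (rule_tac PiE_ext) auto
qed

lemma bij_betw_double: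
  assumes "E ` {1..n} = subspaces"
  shows "bij_betw double (carrier (End_rep \<Gamma> K f)) (carrier (End_system H n E))"
proof -
  have carrier: "carrier (End_system H n E) = {\<phi> \<in> bounded_ops H H. \<forall>F\<in>subspaces. \<phi> ` F \<subseteq> F}"
    unfolding assms[symmetric] by (simp add: End_system_def)
  have "double ` carrier (End_rep \<Gamma> K f) = {\<phi> \<in> bounded_ops H H. \<forall>F\<in>subspaces. \<phi> ` F \<subseteq> F}"
  proof
    show "double ` carrier (End_rep \<Gamma> K f) \<subseteq> {\<phi> \<in> bounded_ops H H. \<forall>F\<in>subspaces. \<phi> ` F \<subseteq> F}"
      using double_op double_preserves_subspaces by blast
    show "{\<phi> \<in> bounded_ops H H. \<forall>F\<in>subspaces. \<phi> ` F \<subseteq> F} \<subseteq> double ` carrier (End_rep \<Gamma> K f)"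
      using double_surj by auto
  qed
  then show ?thesis
    using inj_double by (simp add: bij_betw_def carrier)
qed

lemma End_rep_apply:
  assumes "v \<in> V"
  shows "(S \<otimes>\<^bsub>End_rep \<Gamma> K f\<^esub> T) v = compose (carrier (K v)) (S v) (T v)"
    and "(S \<oplus>\<^bsub>End_rep \<Gamma> K f\<^esub> T) v = (\<lambda>x \<in> carrier (K v). S v x \<oplus>\<^bsub>K v\<^esub> T v x)"
    and "(c \<odot>\<^bsub>End_rep \<Gamma> K f\<^esub> T) v = (\<lambda>x \<in> carrier (K v). c \<odot>\<^bsub>K v\<^esub> T v x)"
    and "\<one>\<^bsub>End_rep \<Gamma> K f\<^esub> v = (\<lambda>x \<in> carrier (K v). x)"
  using assms by (simp_all add: End_rep_def op_algebra_def)

lemma double_mult: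
  assumes S: "S \<in> carrier (End_rep \<Gamma> K f)" and T: "T \<in> carrier (End_rep \<Gamma> K f)"
  shows "double (S \<otimes>\<^bsub>End_rep \<Gamma> K f\<^esub> T) = compose (carrier H) (double S) (double T)"
  unfolding double_def[of "S \<otimes>\<^bsub>End_rep \<Gamma> K f\<^esub> T"] compose_def[of "carrier H"]
  using S T
  by (intro orth.diagonal_eq_restrictI)
    (simp_all add: double_closed component_double vertex_in End_rep_apply compose_eq orth.coord_closed)

lemma double_add:
  assumes S: "S \<in> carrier (End_rep \<Gamma> K f)" and T: "T \<in> carrier (End_rep \<Gamma> K f)"
  shows "double (S \<oplus>\<^bsub>End_rep \<Gamma> K f\<^esub> T) = (\<lambda>z \<in> carrier H. double S z \<oplus>\<^bsub>H\<^esub> double T z)"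
  unfolding double_def[of "S \<oplus>\<^bsub>End_rep \<Gamma> K f\<^esub> T"]
  using S T
  by (intro orth.diagonal_eq_restrictI)
    (simp_all add: double_closed component_double vertex_in orth.closed orth.coord_simps End_rep_apply)

lemma double_smult:
  assumes T: "T \<in> carrier (End_rep \<Gamma> K f)"
  shows "double (c \<odot>\<^bsub>End_rep \<Gamma> K f\<^esub> T) = (\<lambda>z \<in> carrier H. c \<odot>\<^bsub>H\<^esub> double T z)"
  unfolding double_def[of "c \<odot>\<^bsub>End_rep \<Gamma> K f\<^esub> T"]
  using T
  by (intro orth.diagonal_eq_restrictI)
    (simp_all add: double_closed component_double vertex_in orth.closed orth.coord_simps End_rep_apply)

lemma double_one: "double \<one>\<^bsub>End_rep \<Gamma> K f\<^esub> = (\<lambda>z \<in> carrier H. z)"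
  unfolding double_def
  by (intro orth.diagonal_eq_restrictI) (simp_all add: vertex_in orth.coord_closed End_rep_apply)

lemma double_iso:
  assumes "E ` {1..n} = subspaces"
  shows "double \<in> algebra_iso (End_rep \<Gamma> K f) (End_system H n E)"
proof -
  have bij: "bij_betw double (carrier (End_rep \<Gamma> K f)) (carrier (End_system H n E))"
    using assms by (rule bij_betw_double)
  have "double \<in> ring_hom (End_rep \<Gamma> K f) (End_system H n E)"
  proof (rule ring_hom_memI)
    show "double T \<in> carrier (End_system H n E)" if "T \<in> carrier (End_rep \<Gamma> K f)" for T
      using bij that by (rule bij_betw_apply)
  qed (simp_all add: End_system_def op_algebra_def double_mult double_add double_one)
  with bij show ?thesis
    by (simp add: algebra_iso_def ring_iso_def End_system_def op_algebra_def double_smult)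
qed

end

theorem theorem5p3:
  fixes \<Gamma> :: "('v, 'e) pre_digraph"
    and K :: "'v \<Rightarrow> 'a hilbert"
    and f :: "'e \<Rightarrow> 'a \<Rightarrow> 'a"
  assumes "fin_digraph \<Gamma>"
    and "hilbert_representation \<Gamma> K f"
  shows "\<exists>(n :: nat) (H :: ('v, 'a) double_sum hilbert) E.
    subspace_system H n E \<and> algebra_iso (End_rep \<Gamma> K f) (End_system H n E) \<noteq> {}"
proof -
  interpret finite_hilbert_representation \<Gamma> K f
    using assms by (rule finite_hilbert_representation.intro)
  obtain E where "bij_betw E {1..card subspaces} subspaces"
    using ex_bij_betw_nat_finite_1[OF finite_subspaces] by blast
  then have E: "E ` {1..card subspaces} = subspaces"
    by (rule bij_betw_imp_surj_on)
  have "subspace_system H (card subspaces) E"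
    using E closed_subspaces
    by (intro subspace_system.intro subspace_system_axioms.intro orth.hilbert_sum) blast
  moreover have "double \<in> algebra_iso (End_rep \<Gamma> K f) (End_system H (card subspaces) E)"
    using E by (rule double_iso)
  ultimately show ?thesis by blast
qed

end
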